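(* There exists an absolute constant $c>0$ such that the following holds. Let $d=2$, let $\epsilon\in(0,1)$ and put $\epsilon'=\epsilon/c$. Let $k$ and $l$ be positive integers with $$k> d-1+2\cdot 8^{\frac{2}{l}}\frac{(6l)^{1+\frac{1}{l}}}{\epsilon'^2}\qquad\text{and}\qquad l\ge 3d+2 .$$ Then every $l$-wise independent family of hash functions $\mathcal{H}\subseteq [u]\to[u]$ is approximately $d$-$k$-min-wise independent with error bound $\epsilon$.
   Context: Let $[u]=\{0,\dots,u-1\}$. A family $\mathcal{H}$ of functions $[u]\to[u]$ is $l$-wise independent if, for $h$ chosen uniformly at random from $\mathcal{H}$, for any $l$ distinct $x_1,\dots,x_l\in[u]$ and any $v_1,\dots,v_l\in[u]$, $\Pr[h(x_1)=v_1,\dots,h(x_l)=v_l]=u^{-l}$. For a finite set $S$ of numbers, $RANK_j(S)$ denotes the $j$-th smallest element of $S$; for a function $h$ and a set $X$, $h(X)=\{h(x):x\in X\}$. A family $\mathcal{H}$ of functions $[u]\to[u]$ is called approximately $d$-$k$-min-wise independent with error bound $\epsilon\in(0,1)$ if for every $n$, every $X\subseteq[u]$ with $|X|=n-d$ and every $Y\subseteq[u]$ with $|Y|=d$ and $X\cap Y=\emptyset$ (with $d\le k$), we have $$\Pr_{h\in\mathcal{H}}\left[RANK_d(h(Y))<RANK_{k-d+1}(h(X))\right]=\frac{\binom{k}{d}}{\binom{n}{d}}(1\pm\epsilon),$$ i.e. the probability lies between $\frac{\binom{k}{d}}{\binom{n}{d}}(1-\epsilon)$ and $\frac{\binom{k}{d}}{\binom{n}{d}}(1+\epsilon)$,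 where $h$ is chosen uniformly at random from $\mathcal{H}$.
   Formalization: h(X) and h(Y) are taken with multiplicity (colliding values counted separately), since as sets the ranks may not exist and the claim fails for n close to u; and n is required to exceed k, so that RANK_{k-d+1}(h(X)) exists. *)

theory Defs
  imports "HOL-Probability.Probability" "HOL-Library.Multiset" "HOL-Library.FuncSet"
begin

text \<open>
  Functions \<open>[u] \<rightarrow> [u]\<close> are represented as extensional functions on \<open>{..<u}\<close>, so that
  distinct members of a family differ at some point of \<open>[u]\<close> and the uniform distribution on
  the family is \<open>pmf_of_set H\<close>.
\<close>

definition hash_family :: "nat \<Rightarrow> (nat \<Rightarrow> nat) set \<Rightarrow> bool" where
  "hash_family u H \<longleftrightarrow> H \<noteq> {} \<and> H \<subseteq> {..<u} \<rightarrow>\<^sub>E {..<u}"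

definition wise_independent :: "nat \<Rightarrow> nat \<Rightarrow> (nat \<Rightarrow> nat) set \<Rightarrow> bool" where
  "wise_independent u l H \<longleftrightarrow>
     hash_family u H \<and>
     (\<forall>x v. inj_on x {..<l} \<and> x ` {..<l} \<subseteq> {..<u} \<and> v ` {..<l} \<subseteq> {..<u} \<longrightarrow>
        measure_pmf.prob (pmf_of_set H) {h. \<forall>i<l. h (x i) = v i} = 1 / real u ^ l)"

text \<open>
  The \<open>j\<close>-th smallest element, with \<open>j\<close> counted from 1; meaningful for \<open>1 \<le> j \<le> size M\<close>.
  The collection \<open>h(X) = {h(x) : x \<in> X}\<close> of hash values is indexed by \<open>X\<close>: if two points of
  \<open>X\<close> collide, their common value is counted twice, as is usual for ranks of hash values.
  (With collided values merged, the rank of \<open>h(X)\<close> need not exist, and for \<open>card X\<close> close to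
  \<open>u\<close> even a truly random \<open>h\<close> is not approximately min-wise independent.)
\<close>

definition RANK :: "nat \<Rightarrow> 'a::linorder multiset \<Rightarrow> 'a" where
  "RANK j M = sorted_list_of_multiset M ! (j - 1)"

definition hash_values :: "('a \<Rightarrow> 'b) \<Rightarrow> 'a set \<Rightarrow> 'b multiset" where
  "hash_values h X = image_mset h (mset_set X)"

text \<open>
  The condition \<open>k - d + 1 \<le> card X\<close>, that is \<open>k < n\<close>, says that the \<open>(k - d + 1)\<close>-th smallest
  hash value of \<open>X\<close> exists.
\<close>

definition approx_min_wise_independent ::
  "nat \<Rightarrow> nat \<Rightarrow> nat \<Rightarrow> real \<Rightarrow> (nat \<Rightarrow> nat) set \<Rightarrow> bool" where
  "approx_min_wise_independent u d k \<epsilon> H \<longleftrightarrow>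
     hash_family u H \<and> 0 < \<epsilon> \<and> \<epsilon> < 1 \<and> d \<le> k \<and>
     (\<forall>n X Y. X \<subseteq> {..<u} \<and> Y \<subseteq> {..<u} \<and> X \<inter> Y = {} \<and>
        d \<le> n \<and> card X = n - d \<and> card Y = d \<and> k - d + 1 \<le> card X \<longrightarrow>
        measure_pmf.prob (pmf_of_set H)
            {h. RANK d (hash_values h Y) < RANK (k - d + 1) (hash_values h X)}
          \<in> {real (k choose d) / real (n choose d) * (1 - \<epsilon>) ..
             real (k choose d) / real (n choose d) * (1 + \<epsilon>)})"

end

theory Submission
  imports Defs
begin

text \<open>
  Write \<open>d = card Y\<close>, \<open>m = card X\<close>, \<open>K = k - d + 1\<close> and \<open>t = Max (h ` Y)\<close>. The event says that
  fewer than \<open>K\<close> points of \<open>X\<close> hash into \<open>{..t}\<close>, where \<open>m * (t + 1) / u\<close> of them are expected.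
  So up to an error it says that \<open>t + 1\<close> is at most \<open>cutoff = u * K / m\<close>, which has probability about
  \<open>(K / m) ^ d\<close>. An error requires the number of points hashing into \<open>{..t}\<close> and its mean to lie on
  different sides of \<open>K\<close>. Given the hash values of \<open>Y\<close>, the family is still \<open>(l - d)\<close>-wise
  independent on \<open>X\<close>, so Chebyshev's inequality controls errors for \<open>t\<close> of the order of \<open>cutoff\<close>,
  and a product of \<open>d + 1\<close> squared deviations over disjoint parts of \<open>X\<close> does for larger \<open>t\<close>; this is
  where \<open>l \<ge> d + 2 * (d + 1)\<close> is used. Together the bounds decay in \<open>t\<close> like
  \<open>1 / (1 + ((t - cutoff) / width)\<^sup>2)\<close> with \<open>width = cutoff / sqrt K\<close>, and summing over \<open>t\<close> leaves a
  relative error of order \<open>1 / sqrt K\<close>. Nothing depends on \<open>d = 2\<close> except the value of the constant.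
\<close>

subsection \<open>Moments under limited independence\<close>

definition hit_count :: "'b set \<Rightarrow> 'a set \<Rightarrow> ('a \<Rightarrow> 'b) \<Rightarrow> nat" where
  "hit_count E Z h = card {x \<in> Z. h x \<in> E}"

lemma hit_count_mono: "finite Z \<Longrightarrow> W \<subseteq> Z \<Longrightarrow> hit_count E W h \<le> hit_count E Z h"
  unfolding hit_count_def by (intro card_mono) auto

lemma hit_count_eq_sum_indicator:
  "finite Z \<Longrightarrow> real (hit_count E Z h) = (\<Sum>x\<in>Z. indicator E (h x))"
  by (simp add: hit_count_def indicator_def sum.If_cases Int_def)

lemma
  fixes q :: "'b pmf"
  shows expectation_centred_indicator:
      "measure_pmf.expectation q (\<lambda>v. indicator E v - measure_pmf.prob q E) = 0"
    and expectation_centred_indicator_square_le: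
      "measure_pmf.expectation q (\<lambda>v. (indicator E v - measure_pmf.prob q E)\<^sup>2)
        \<le> measure_pmf.prob q E"
proof -
  have integrable: "integrable q (indicator E :: 'b \<Rightarrow> real)"
    by (intro integrable_real_indicator) (auto simp: measure_pmf.emeasure_eq_measure)
  then show "measure_pmf.expectation q (\<lambda>v. indicator E v - measure_pmf.prob q E) = 0"
    by (subst Bochner_Integration.integral_diff) simp_all
  have square: "(indicator E v :: real)\<^sup>2 = indicator E v" for v
    by (simp add: indicator_def)
  have "measure_pmf.variance q (indicator E)
      = measure_pmf.prob q E - (measure_pmf.prob q E)\<^sup>2"
    using integrable by (subst measure_pmf.variance_eq) (simp_all add: square)
  then show "measure_pmf.expectation q (\<lambda>v. (indicator E v - measure_pmf.prob q E)\<^sup>2)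
      \<le> measure_pmf.prob q E"
    by simp
qed

definition factorizes ::
    "('a \<Rightarrow> 'b) pmf \<Rightarrow> 'b pmf \<Rightarrow> 'a set \<Rightarrow> nat \<Rightarrow> (('a \<Rightarrow> 'b) \<Rightarrow> real) \<Rightarrow> real \<Rightarrow> bool" where
  "factorizes p q W n G \<gamma> \<longleftrightarrow>
     (\<forall>S f. finite S \<longrightarrow> S \<subseteq> W \<longrightarrow> card S \<le> n \<longrightarrow>
        measure_pmf.expectation p (\<lambda>h. (\<Prod>x\<in>S. f x (h x)) * G h)
          = (\<Prod>x\<in>S. measure_pmf.expectation q (f x)) * \<gamma>)"

lemma factorizesD:
  "\<lbrakk>factorizes p q W n G \<gamma>; finite S; S \<subseteq> W; card S \<le> n\<rbrakk> \<Longrightarrow>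
     measure_pmf.expectation p (\<lambda>h. (\<Prod>x\<in>S. f x (h x)) * G h)
       = (\<Prod>x\<in>S. measure_pmf.expectation q (f x)) * \<gamma>"
  by (simp add: factorizes_def)

lemma factorizes_mult_centred_pair:
  assumes G: "factorizes p q W (n + 2) G \<gamma>" and \<phi>: "measure_pmf.expectation q \<phi> = 0"
    and yz: "y \<in> W" "z \<in> W"
  shows "factorizes p q (W - {y, z}) n (\<lambda>h. \<phi> (h y) * \<phi> (h z) * G h)
    (if y = z then measure_pmf.expectation q (\<lambda>v. (\<phi> v)\<^sup>2) * \<gamma> else 0)"
  unfolding factorizes_def
proof (intro allI impI)
  fix S and f :: "'a \<Rightarrow> 'b \<Rightarrow> real"
  assume S: "finite S" "S \<subseteq> W - {y, z}" "card S \<le> n"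
  then have notin: "y \<notin> S" "z \<notin> S"
    by auto
  define g where "g = (if y = z then f(y := \<lambda>v. (\<phi> v)\<^sup>2) else f(y := \<phi>, z := \<phi>))"
  have g_S: "g x = f x" if "x \<in> S" for x
    using notin that by (auto simp: g_def)
  have "measure_pmf.expectation p (\<lambda>h. (\<Prod>x\<in>S. f x (h x)) * (\<phi> (h y) * \<phi> (h z) * G h))
      = measure_pmf.expectation p (\<lambda>h. (\<Prod>x\<in>S \<union> {y, z}. g x (h x)) * G h)"
    using S(1) notin
    by (cases "y = z") (simp_all add: g_S, simp_all add: g_def power2_eq_square mult_ac)
  also have "\<dots> = (\<Prod>x\<in>S \<union> {y, z}. measure_pmf.expectation q (g x)) * \<gamma>"
  proof (rule factorizesD[OF G])
    show "card (S \<union> {y, z}) \<le> n + 2"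
      using S(3) card_Un_le[of S "{y, z}"] by (simp add: card_insert_if split: if_splits)
  qed (use S yz in auto)
  also have "\<dots> = (\<Prod>x\<in>S. measure_pmf.expectation q (f x))
      * (if y = z then measure_pmf.expectation q (\<lambda>v. (\<phi> v)\<^sup>2) * \<gamma> else 0)"
    using S(1) notin \<phi>
    by (cases "y = z") (simp_all add: g_S, simp_all add: g_def)
  finally show "measure_pmf.expectation p (\<lambda>h. (\<Prod>x\<in>S. f x (h x)) * (\<phi> (h y) * \<phi> (h z) * G h))
      = (\<Prod>x\<in>S. measure_pmf.expectation q (f x))
        * (if y = z then measure_pmf.expectation q (\<lambda>v. (\<phi> v)\<^sup>2) * \<gamma> else 0)" .
qed

lemma factorizes_mult_centred_sum_square:
  assumes p: "finite (set_pmf p)"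
    and G: "factorizes p q W (n + 2) G \<gamma>" and \<phi>: "measure_pmf.expectation q \<phi> = 0"
    and Z: "finite Z" "Z \<subseteq> W"
  shows "factorizes p q (W - Z) n (\<lambda>h. (\<Sum>x\<in>Z. \<phi> (h x))\<^sup>2 * G h)
    (real (card Z) * measure_pmf.expectation q (\<lambda>v. (\<phi> v)\<^sup>2) * \<gamma>)"
  unfolding factorizes_def
proof (intro allI impI)
  fix S and f :: "'a \<Rightarrow> 'b \<Rightarrow> real"
  assume S: "finite S" "S \<subseteq> W - Z" "card S \<le> n"
  define s where "s = measure_pmf.expectation q (\<lambda>v. (\<phi> v)\<^sup>2)"
  have "measure_pmf.expectation p (\<lambda>h. (\<Prod>x\<in>S. f x (h x)) * ((\<Sum>x\<in>Z. \<phi> (h x))\<^sup>2 * G h))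
      = measure_pmf.expectation p
          (\<lambda>h. \<Sum>y\<in>Z. \<Sum>z\<in>Z. (\<Prod>x\<in>S. f x (h x)) * (\<phi> (h y) * \<phi> (h z) * G h))"
    by (simp add: power2_eq_square sum_product sum_distrib_left sum_distrib_right mult_ac)
  also have "\<dots> = (\<Sum>y\<in>Z. \<Sum>z\<in>Z.
      measure_pmf.expectation p (\<lambda>h. (\<Prod>x\<in>S. f x (h x)) * (\<phi> (h y) * \<phi> (h z) * G h)))"
    by (simp add: integrable_measure_pmf_finite[OF p])
  also have "\<dots> = (\<Sum>y\<in>Z. \<Sum>z\<in>Z.
      (\<Prod>x\<in>S. measure_pmf.expectation q (f x)) * (if y = z then s * \<gamma> else 0))"
    unfolding s_def using S Z
    by (intro sum.cong refl factorizesD[OF factorizes_mult_centred_pair[OF G \<phi>]]) auto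
  also have "\<dots> = (\<Prod>x\<in>S. measure_pmf.expectation q (f x)) * (real (card Z) * s * \<gamma>)"
    using Z by (simp add: if_distrib cong: if_cong)
  finally show "measure_pmf.expectation p
        (\<lambda>h. (\<Prod>x\<in>S. f x (h x)) * ((\<Sum>x\<in>Z. \<phi> (h x))\<^sup>2 * G h))
      = (\<Prod>x\<in>S. measure_pmf.expectation q (f x))
        * (real (card Z) * measure_pmf.expectation q (\<lambda>v. (\<phi> v)\<^sup>2) * \<gamma>)"
    by (simp add: s_def)
qed

locale wise_iid =
  fixes l :: nat and A :: "'a set" and q :: "'b pmf" and p :: "('a \<Rightarrow> 'b) pmf"
  assumes finite_set_pmf: "finite (set_pmf p)"
    and map_pmf_restrict: "\<lbrakk>finite S; S \<subseteq> A; card S \<le> l\<rbrakk> \<Longrightarrow>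
      map_pmf (\<lambda>h. restrict h S) p = Pi_pmf S undefined (\<lambda>_. q)"
begin

lemma map_pmf_apply:
  assumes "x \<in> A" "1 \<le> l"
  shows "map_pmf (\<lambda>h. h x) p = q"
proof -
  have "map_pmf (\<lambda>h. h x) p = map_pmf (\<lambda>h. h x) (map_pmf (\<lambda>h. restrict h {x}) p)"
    by (simp add: pmf.map_comp o_def)
  also have "\<dots> = q"
    using assms by (simp add: map_pmf_restrict Pi_pmf_component)
  finally show ?thesis .
qed

lemma expectation_prod:
  fixes f :: "'a \<Rightarrow> 'b \<Rightarrow> real"
  assumes S: "finite S" "S \<subseteq> A" "card S \<le> l"
  shows "measure_pmf.expectation p (\<lambda>h. \<Prod>x\<in>S. f x (h x))
    = (\<Prod>x\<in>S. measure_pmf.expectation q (f x))"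
proof -
  define P where "P = Pi_pmf S undefined (\<lambda>_. q)"
  have P: "P = map_pmf (\<lambda>h. restrict h S) p"
    using map_pmf_restrict[OF S] by (simp add: P_def)
  have "finite (set_pmf P)"
    using finite_set_pmf by (simp add: P)
  then have integrable_P: "integrable P g" for g :: "('a \<Rightarrow> 'b) \<Rightarrow> real"
    by (rule integrable_measure_pmf_finite)
  have "prob_space.indep_vars P (\<lambda>_. borel) (\<lambda>x h. f x (h x)) S"
    using indep_vars_Pi_pmf[OF S(1)] unfolding P_def
    by (rule prob_space.indep_vars_compose2[OF measure_pmf.prob_space_axioms]) simp
  then have "measure_pmf.expectation P (\<lambda>h. \<Prod>x\<in>S. f x (h x))
      = (\<Prod>x\<in>S. measure_pmf.expectation P (\<lambda>h. f x (h x)))"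
    using S(1) integrable_P
    by (intro prob_space.indep_vars_lebesgue_integral measure_pmf.prob_space_axioms) auto
  also have "\<dots> = (\<Prod>x\<in>S. measure_pmf.expectation (map_pmf (\<lambda>h. h x) P) (f x))"
    by simp
  also have "\<dots> = (\<Prod>x\<in>S. measure_pmf.expectation q (f x))"
    unfolding P_def using S(1) by (intro prod.cong) (simp_all add: Pi_pmf_component)
  finally show ?thesis
    by (simp add: P)
qed

lemma prob_all_in:
  assumes "finite S" "S \<subseteq> A" "card S \<le> l"
  shows "measure_pmf.prob p {h. \<forall>x\<in>S. h x \<in> B x} = (\<Prod>x\<in>S. measure_pmf.prob q (B x))"
proof -
  have "indicator {h. \<forall>x\<in>S. h x \<in> B x} = (\<lambda>h. \<Prod>x\<in>S. indicat_real (B x) (h x))"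
    using assms(1) by (auto simp: indicator_def fun_eq_iff)
  then have "measure_pmf.expectation p (indicat_real {h. \<forall>x\<in>S. h x \<in> B x})
      = measure_pmf.expectation p (\<lambda>h. \<Prod>x\<in>S. indicat_real (B x) (h x))"
    by (rule arg_cong)
  then show ?thesis
    using expectation_prod[OF assms, of "\<lambda>x. indicator (B x)"] by simp
qed

lemma factorizes_prod_centred_sum_squares:
  assumes \<phi>: "measure_pmf.expectation q \<phi> = 0"
    and "finite I" "n + 2 * card I \<le> l"
    and "\<And>i. i \<in> I \<Longrightarrow> finite (Z i)" "\<And>i. i \<in> I \<Longrightarrow> Z i \<subseteq> A" "disjoint_family_on Z I"
  shows "factorizes p q (A - (\<Union>i\<in>I. Z i)) n (\<lambda>h. \<Prod>i\<in>I. (\<Sum>x\<in>Z i. \<phi> (h x))\<^sup>2)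
    (\<Prod>i\<in>I. real (card (Z i)) * measure_pmf.expectation q (\<lambda>v. (\<phi> v)\<^sup>2))"
  using assms(2-)
proof (induction I arbitrary: n rule: finite_induct)
  case empty
  then show ?case
    by (simp add: factorizes_def expectation_prod)
next
  case (insert i I)
  have "disjoint_family_on Z I" and disjoint: "Z i \<inter> (\<Union>j\<in>I. Z j) = {}"
    using insert.prems(4) insert.hyps by (auto simp: disjoint_family_on_def)
  then have "factorizes p q (A - (\<Union>j\<in>I. Z j)) (n + 2) (\<lambda>h. \<Prod>j\<in>I. (\<Sum>x\<in>Z j. \<phi> (h x))\<^sup>2)
      (\<Prod>j\<in>I. real (card (Z j)) * measure_pmf.expectation q (\<lambda>v. (\<phi> v)\<^sup>2))"
    using insert.hyps insert.prems by (intro insert.IH) auto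
  moreover have "A - (\<Union>j\<in>insert i I. Z j) = A - (\<Union>j\<in>I. Z j) - Z i"
    by auto
  ultimately show ?case
    using insert.hyps insert.prems disjoint
    by (auto intro!: factorizes_mult_centred_sum_square[OF finite_set_pmf _ \<phi>])
qed

lemma expectation_prod_indicator_mult_deviation_squares_le:
  fixes Z :: "'i \<Rightarrow> 'a set" and B :: "'a \<Rightarrow> 'b set" and E :: "'b set"
  assumes S: "finite S" "S \<subseteq> A" "card S + 2 * card I \<le> l" and I: "finite I"
    and Z: "\<And>i. i \<in> I \<Longrightarrow> finite (Z i)" "\<And>i. i \<in> I \<Longrightarrow> Z i \<subseteq> A - S" "disjoint_family_on Z I"
  shows "measure_pmf.expectation p (\<lambda>h. (\<Prod>x\<in>S. indicat_real (B x) (h x)) *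
        (\<Prod>i\<in>I. (real (hit_count E (Z i) h) - real (card (Z i)) * measure_pmf.prob q E)\<^sup>2))
    \<le> (\<Prod>x\<in>S. measure_pmf.prob q (B x)) * (\<Prod>i\<in>I. real (card (Z i)) * measure_pmf.prob q E)"
proof -
  define \<phi> where "\<phi> v = indicator E v - measure_pmf.prob q E" for v
  have "real (hit_count E (Z i) h) - real (card (Z i)) * measure_pmf.prob q E
      = (\<Sum>x\<in>Z i. \<phi> (h x))" if "i \<in> I" for i h
    using Z(1)[OF that] by (simp add: hit_count_eq_sum_indicator \<phi>_def sum_subtractf)
  then have "measure_pmf.expectation p (\<lambda>h. (\<Prod>x\<in>S. indicat_real (B x) (h x)) *
        (\<Prod>i\<in>I. (real (hit_count E (Z i) h) - real (card (Z i)) * measure_pmf.prob q E)\<^sup>2))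
      = measure_pmf.expectation p (\<lambda>h. (\<Prod>x\<in>S. indicat_real (B x) (h x)) *
          (\<Prod>i\<in>I. (\<Sum>x\<in>Z i. \<phi> (h x))\<^sup>2))"
    by simp
  also have "\<dots> = (\<Prod>x\<in>S. measure_pmf.expectation q (indicat_real (B x)))
      * (\<Prod>i\<in>I. real (card (Z i)) * measure_pmf.expectation q (\<lambda>v. (\<phi> v)\<^sup>2))"
  proof (rule factorizesD[OF factorizes_prod_centred_sum_squares])
    show "measure_pmf.expectation q \<phi> = 0"
      unfolding \<phi>_def by (rule expectation_centred_indicator)
    show "S \<subseteq> A - (\<Union>i\<in>I. Z i)"
      using S(2) Z(2) by blast
    show "Z i \<subseteq> A" if "i \<in> I" for i
      using Z(2)[OF that] by blast
  qed (use S I Z in auto)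
  also have "\<dots> = (\<Prod>x\<in>S. measure_pmf.prob q (B x))
      * (\<Prod>i\<in>I. real (card (Z i)) * measure_pmf.expectation q (\<lambda>v. (\<phi> v)\<^sup>2))"
    by simp
  also have "\<dots> \<le> (\<Prod>x\<in>S. measure_pmf.prob q (B x))
      * (\<Prod>i\<in>I. real (card (Z i)) * measure_pmf.prob q E)"
    unfolding \<phi>_def
    by (intro mult_left_mono prod_mono conjI expectation_centred_indicator_square_le)
      (auto intro!: mult_nonneg_nonneg prod_nonneg)
  finally show ?thesis .
qed

text \<open>Markov's inequality, cleared of denominators so that \<open>\<delta> = 0\<close> needs no separate treatment.\<close>

lemma prob_deviations_le:
  fixes Z :: "'i \<Rightarrow> 'a set" and B :: "'a \<Rightarrow> 'b set" and E :: "'b set"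
  assumes S: "finite S" "S \<subseteq> A" "card S + 2 * card I \<le> l" and I: "finite I"
    and Z: "\<And>i. i \<in> I \<Longrightarrow> finite (Z i)" "\<And>i. i \<in> I \<Longrightarrow> Z i \<subseteq> A - S" "disjoint_family_on Z I"
    and "0 \<le> \<delta>"
  shows "measure_pmf.prob p {h. (\<forall>x\<in>S. h x \<in> B x) \<and>
        (\<forall>i\<in>I. \<delta> \<le> \<bar>real (hit_count E (Z i) h) - real (card (Z i)) * measure_pmf.prob q E\<bar>)}
      * (\<delta>\<^sup>2) ^ card I
    \<le> (\<Prod>x\<in>S. measure_pmf.prob q (B x)) * (\<Prod>i\<in>I. real (card (Z i)) * measure_pmf.prob q E)"
    (is "measure_pmf.prob p ?D * _ \<le> ?R")
proof -
  define deviation where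
    "deviation i h = real (hit_count E (Z i) h) - real (card (Z i)) * measure_pmf.prob q E" for i h
  define V where "V h = (\<Prod>x\<in>S. indicat_real (B x) (h x)) * (\<Prod>i\<in>I. (deviation i h)\<^sup>2)" for h
  have "indicator ?D h * (\<delta>\<^sup>2) ^ card I \<le> V h" for h
  proof (cases "h \<in> ?D")
    case True
    have "(\<Prod>i\<in>I. \<delta>\<^sup>2) \<le> (\<Prod>i\<in>I. (deviation i h)\<^sup>2)"
      using True \<open>0 \<le> \<delta>\<close>
      by (intro prod_mono) (auto simp: deviation_def simp flip: abs_le_square_iff)
    then show ?thesis
      using True by (simp add: V_def)
  qed (simp add: V_def prod_nonneg)
  then have "measure_pmf.expectation p (\<lambda>h. indicator ?D h * (\<delta>\<^sup>2) ^ card I)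
      \<le> measure_pmf.expectation p V"
    by (intro integral_mono integrable_measure_pmf_finite finite_set_pmf)
  also have "measure_pmf.expectation p V \<le> ?R"
    unfolding V_def deviation_def
    by (rule expectation_prod_indicator_mult_deviation_squares_le[OF S I Z])
  finally show ?thesis
    by simp
qed

end

subsection \<open>Hit counts against a threshold\<close>

lemma obtain_disjoint_equal_parts:
  assumes "finite X" "0 < j" "j \<le> card X"
  obtains Z :: "nat \<Rightarrow> 'a set" and n
  where "\<And>i. i < j \<Longrightarrow> Z i \<subseteq> X" "\<And>i. i < j \<Longrightarrow> card (Z i) = n" "disjoint_family_on Z {..<j}"
    and "card X \<le> 2 * j * n"
proof -
  obtain e where e: "bij_betw e {..<card X} X"
    using ex_bij_betw_nat_finite[OF assms(1)] by (auto simp: atLeast0LessThan)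
  define n where "n = card X div j"
  define I where "I i = {i * n..<Suc i * n}" for i
  have I: "I i \<subseteq> {..<card X}" if "i < j" for i
  proof -
    have "Suc i * n \<le> j * n"
      using that by (intro mult_le_mono1) simp
    also have "\<dots> \<le> card X"
      unfolding n_def by (rule times_div_less_eq_dividend)
    finally show ?thesis
      by (auto simp: I_def)
  qed
  have I_disjoint: "I i \<inter> I i' = {}" if "i < i'" for i i'
    using mult_le_mono1[of "Suc i" i' n] that by (auto simp: I_def)
  show thesis
  proof (rule that[of "\<lambda>i. e ` I i" n])
    show "e ` I i \<subseteq> X" if "i < j" for i
      using I[OF that] e by (auto simp: bij_betw_def)
    show "card (e ` I i) = n" if "i < j" for i
      using card_image[OF inj_on_subset[OF bij_betw_imp_inj_on[OF e] I[OF that]]]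
      by (simp add: I_def)
    show "disjoint_family_on (\<lambda>i. e ` I i) {..<j}"
      unfolding disjoint_family_on_def
    proof (intro ballI impI)
      fix i i' assume i: "i \<in> {..<j}" "i' \<in> {..<j}" "i \<noteq> i'"
      then have "I i \<inter> I i' = {}"
        using I_disjoint[of i i'] I_disjoint[of i' i]
        by (cases i i' rule: linorder_cases) auto
      then show "e ` I i \<inter> e ` I i' = {}"
        using inj_on_image_Int[OF bij_betw_imp_inj_on[OF e] I I, of i i'] i by simp
    qed
    have "0 < n"
      using assms by (simp add: n_def div_greater_zero_iff)
    then have "j \<le> j * n"
      by simp
    then show "card X \<le> 2 * j * n"
      using assms(2) dividend_less_times_div[of j "card X"] unfolding n_def mult.assoc by linarith
  qed
qed

definition straddles :: "nat \<Rightarrow> 'b pmf \<Rightarrow> 'b set \<Rightarrow> 'a set \<Rightarrow> ('a \<Rightarrow> 'b) \<Rightarrow> bool" where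
  "straddles K q E X h \<longleftrightarrow>
     (hit_count E X h < K) \<noteq> (real (card X) * measure_pmf.prob q E \<le> real K)"

context wise_iid
begin

lemma prob_straddles_mult_square_le:
  fixes B :: "'a \<Rightarrow> 'b set" and E :: "'b set"
  assumes S: "finite S" "S \<subseteq> A" "card S + 2 \<le> l" and X: "finite X" "X \<subseteq> A - S"
  defines "\<mu> \<equiv> real (card X) * measure_pmf.prob q E"
  shows "measure_pmf.prob p {h. (\<forall>x\<in>S. h x \<in> B x) \<and> straddles K q E X h} * (\<mu> - real K)\<^sup>2
    \<le> (\<Prod>x\<in>S. measure_pmf.prob q (B x)) * \<mu>"
    (is "?P * _ \<le> ?Q * _")
proof -
  define D where "D = {h. (\<forall>x\<in>S. h x \<in> B x) \<and>
    (\<forall>i\<in>{()}. \<bar>\<mu> - real K\<bar> \<le> \<bar>real (hit_count E X h) - \<mu>\<bar>)}"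
  have "\<bar>\<mu> - real K\<bar> \<le> \<bar>real (hit_count E X h) - \<mu>\<bar>" if "straddles K q E X h" for h
    using that unfolding straddles_def \<mu>_def by linarith
  then have "?P \<le> measure_pmf.prob p D"
    unfolding D_def by (intro measure_pmf.finite_measure_mono) auto
  then have "?P * (\<mu> - real K)\<^sup>2 \<le> measure_pmf.prob p D * (\<bar>\<mu> - real K\<bar>\<^sup>2) ^ card {()}"
    by (simp add: mult_right_mono)
  also have "\<dots> \<le> ?Q * (\<Prod>i\<in>{()}. \<mu>)"
    unfolding D_def \<mu>_def using S X
    by (intro prob_deviations_le) (auto simp: disjoint_family_on_def)
  finally show ?thesis
    by simp
qed

text \<open>
  Few hits in all of \<open>X\<close> means few hits in each of \<open>j\<close> disjoint equal parts of \<open>X\<close>, and the product of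
  the \<open>j\<close> squared deviations has degree \<open>2 * j\<close> only: the decay beats Chebyshev's for large means.
\<close>

lemma prob_hit_count_less_le:
  fixes B :: "'a \<Rightarrow> 'b set" and E :: "'b set"
  assumes S: "finite S" "S \<subseteq> A" "card S + 2 * j \<le> l" and X: "finite X" "X \<subseteq> A - S"
    and Z: "\<And>i. i < j \<Longrightarrow> Z i \<subseteq> X" "\<And>i. i < j \<Longrightarrow> card (Z i) = n" "disjoint_family_on Z {..<j}"
    and "0 < K"
  defines "\<nu> \<equiv> real n * measure_pmf.prob q E"
  assumes \<nu>: "2 * real K \<le> \<nu>"
  shows "measure_pmf.prob p {h. (\<forall>x\<in>S. h x \<in> B x) \<and> hit_count E X h < K} * (\<nu> / 4) ^ j
    \<le> (\<Prod>x\<in>S. measure_pmf.prob q (B x))"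
    (is "?P * _ \<le> ?Q")
proof -
  have "0 < \<nu>"
    using \<nu> \<open>0 < K\<close> by linarith
  have deviation: "\<nu> / 2 \<le> \<bar>real (hit_count E (Z i) h) - real (card (Z i)) * measure_pmf.prob q E\<bar>"
    if "hit_count E X h < K" "i < j" for h i
    using that hit_count_mono[OF X(1) Z(1)[OF that(2)], of E h] \<nu>
    by (simp add: Z(2) flip: \<nu>_def)
  have "?P * ((\<nu> / 2)\<^sup>2) ^ card {..<j} \<le> measure_pmf.prob p {h. (\<forall>x\<in>S. h x \<in> B x) \<and>
      (\<forall>i\<in>{..<j}. \<nu> / 2 \<le> \<bar>real (hit_count E (Z i) h) - real (card (Z i)) * measure_pmf.prob q E\<bar>)}
      * ((\<nu> / 2)\<^sup>2) ^ card {..<j}"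
    using deviation by (intro mult_right_mono measure_pmf.finite_measure_mono) auto
  also have "\<dots> \<le> ?Q * (\<Prod>i\<in>{..<j}. real (card (Z i)) * measure_pmf.prob q E)"
  proof (rule prob_deviations_le)
    show "finite (Z i)" "Z i \<subseteq> A - S" if "i \<in> {..<j}" for i
      using Z(1)[of i] X that finite_subset by auto
  qed (use S Z \<open>0 < \<nu>\<close> in auto)
  also have "\<dots> = ?Q * \<nu> ^ j"
    by (simp add: Z(2) flip: \<nu>_def)
  finally have "?P * (\<nu> / 4) ^ j * \<nu> ^ j \<le> ?Q * \<nu> ^ j"
    by (simp add: power_divide power_mult_distrib power2_eq_square)
  then show ?thesis
    using \<open>0 < \<nu>\<close> by simp
qed

lemma prob_hit_count_less_mult_power_le:
  fixes B :: "'a \<Rightarrow> 'b set" and E :: "'b set"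
  assumes S: "finite S" "S \<subseteq> A" "card S + 2 * j \<le> l" and X: "finite X" "X \<subseteq> A - S"
    and j: "0 < j" "j \<le> card X" and "0 < K"
  defines "\<mu> \<equiv> real (card X) * measure_pmf.prob q E"
  assumes large: "4 * real j * real K \<le> \<mu>"
  shows "measure_pmf.prob p {h. (\<forall>x\<in>S. h x \<in> B x) \<and> hit_count E X h < K} * \<mu> ^ j
    \<le> (8 * real j) ^ j * (\<Prod>x\<in>S. measure_pmf.prob q (B x))"
    (is "?P * _ \<le> _ * ?Q")
proof -
  obtain Z n where Z: "\<And>i. i < j \<Longrightarrow> Z i \<subseteq> X" "\<And>i. i < j \<Longrightarrow> card (Z i) = n"
      "disjoint_family_on Z {..<j}" and n: "card X \<le> 2 * j * n"
    by (rule obtain_disjoint_equal_parts[OF X(1) j]) (rule that)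
  define \<nu> where "\<nu> = real n * measure_pmf.prob q E"
  have "real (card X) \<le> 2 * real j * real n"
    using of_nat_mono[OF n, where 'a = real] by simp
  then have \<mu>_le: "\<mu> \<le> 2 * real j * \<nu>"
    unfolding \<mu>_def \<nu>_def mult.assoc[symmetric] by (intro mult_right_mono) auto
  then have "2 * real j * (2 * real K) \<le> 2 * real j * \<nu>"
    using large by linarith
  then have "2 * real K \<le> \<nu>"
    using j(1) by simp
  have "\<mu> \<le> 8 * real j * (\<nu> / 4)"
    using \<mu>_le by linarith
  then have "?P * \<mu> ^ j \<le> ?P * (8 * real j * (\<nu> / 4)) ^ j"
    by (intro mult_left_mono power_mono) (simp_all add: \<mu>_def)
  also have "\<dots> = (8 * real j) ^ j * (?P * (\<nu> / 4) ^ j)"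
    by (simp only: power_mult_distrib mult_ac)
  also have "\<dots> \<le> (8 * real j) ^ j * ?Q"
    using prob_hit_count_less_le[OF S X Z \<open>0 < K\<close>] \<open>2 * real K \<le> \<nu>\<close>
    by (intro mult_left_mono) (auto simp: \<nu>_def)
  finally show ?thesis .
qed

lemma prob_straddles_mult_one_plus_square_le:
  fixes B :: "'a \<Rightarrow> 'b set" and E :: "'b set"
  assumes S: "finite S" "S \<subseteq> A" "card S + 2 \<le> l" and X: "finite X" "X \<subseteq> A - S" and "0 < K"
  defines "\<xi> \<equiv> real (card X) * measure_pmf.prob q E / real K"
  shows "measure_pmf.prob p {h. (\<forall>x\<in>S. h x \<in> B x) \<and> straddles K q E X h}
      * (1 + real K * (\<xi> - 1)\<^sup>2)
    \<le> (1 + \<xi>) * (\<Prod>x\<in>S. measure_pmf.prob q (B x))"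
    (is "?P * _ \<le> _ * ?Q")
proof -
  have \<mu>: "real (card X) * measure_pmf.prob q E = real K * \<xi>"
    using \<open>0 < K\<close> by (simp add: \<xi>_def)
  have "?P * (real K * \<xi> - real K)\<^sup>2 \<le> ?Q * (real K * \<xi>)"
    using prob_straddles_mult_square_le[OF S X, of B K E] by (simp add: \<mu>)
  moreover have "(real K * \<xi> - real K)\<^sup>2 = real K * (real K * (\<xi> - 1)\<^sup>2)"
    by (simp add: power2_eq_square algebra_simps)
  ultimately have "real K * (?P * (real K * (\<xi> - 1)\<^sup>2)) \<le> real K * (\<xi> * ?Q)"
    by (simp only: mult_ac)
  then have "?P * (real K * (\<xi> - 1)\<^sup>2) \<le> \<xi> * ?Q"
    using \<open>0 < K\<close> by simp
  moreover have "?P \<le> measure_pmf.prob p {h. \<forall>x\<in>S. h x \<in> B x}"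
    by (intro measure_pmf.finite_measure_mono) auto
  then have "?P \<le> ?Q"
    using prob_all_in[OF S(1,2)] S(3) by simp
  ultimately show ?thesis
    unfolding distrib_left distrib_right by linarith
qed

end

lemma power_mult_one_plus_square_le:
  fixes a x :: real
  assumes "1 \<le> a" "1 \<le> x"
  shows "x ^ d * (1 + a * (x - 1)\<^sup>2) \<le> x * (a * x) ^ (d + 1)"
proof -
  have "1 * a \<le> a * x" "1 * 1 \<le> a * x"
    using assms by (simp, intro mult_mono) auto
  then have "1 + a * (x - 1)\<^sup>2 \<le> a * x\<^sup>2"
    by (simp add: power2_eq_square algebra_simps)
  then have "x ^ d * (1 + a * (x - 1)\<^sup>2) \<le> x ^ d * (a * x\<^sup>2)"
    using assms by (intro mult_left_mono) auto
  also have "\<dots> = x * (a * x ^ (d + 1))"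
    by (simp add: power2_eq_square)
  also have "\<dots> \<le> x * (a ^ (d + 1) * x ^ (d + 1))"
    using assms by (intro mult_left_mono mult_right_mono self_le_power) auto
  finally show ?thesis
    by (simp only: power_mult_distrib)
qed

definition straddle_const :: "nat \<Rightarrow> real" where
  "straddle_const d = (8 * (real d + 1)) ^ (d + 1)"

lemma power_mult_one_plus_le_straddle_const:
  fixes x :: real
  assumes "0 < d" "0 \<le> x" "x \<le> 4 * (real d + 1)"
  shows "x ^ d * (1 + x) \<le> straddle_const d * x"
proof -
  define b where "b = 8 * (real d + 1)"
  have "1 + x \<le> b"
    using assms by (simp add: b_def)
  also have "\<dots> \<le> b\<^sup>2"
    by (intro self_le_power) (auto simp: b_def)
  finally have "x ^ (d - 1) * (1 + x) \<le> b ^ (d - 1) * b\<^sup>2"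
    using assms by (intro mult_mono power_mono) (auto simp: b_def)
  also have "\<dots> = straddle_const d"
    using assms(1) unfolding straddle_const_def b_def[symmetric] power_add[symmetric] by simp
  finally have "x * (x ^ (d - 1) * (1 + x)) \<le> x * straddle_const d"
    using assms(2) by (rule mult_left_mono)
  then show ?thesis
    using assms(1) by (simp add: power_eq_if mult_ac)
qed

lemma (in wise_iid) prob_straddles_le:
  fixes B :: "'a \<Rightarrow> 'b set" and E :: "'b set"
  assumes S: "finite S" "S \<subseteq> A" "S \<noteq> {}" "3 * card S + 2 \<le> l"
    and X: "finite X" "X \<subseteq> A - S" "card S < card X" and "0 < K"
  defines "\<xi> \<equiv> real (card X) * measure_pmf.prob q E / real K"
  shows "measure_pmf.prob p {h. (\<forall>x\<in>S. h x \<in> B x) \<and> straddles K q E X h}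
      * (\<xi> ^ card S * (1 + real K * (\<xi> - 1)\<^sup>2))
    \<le> straddle_const (card S) * \<xi> * (\<Prod>x\<in>S. measure_pmf.prob q (B x))"
    (is "?P * _ \<le> _ * ?Q")
proof -
  have "0 \<le> \<xi>" "0 \<le> ?Q"
    by (auto simp: \<xi>_def prod_nonneg)
  have \<mu>: "real (card X) * measure_pmf.prob q E = real K * \<xi>"
    using \<open>0 < K\<close> by (simp add: \<xi>_def)
  show ?thesis
  proof (cases "\<xi> \<le> 4 * (real (card S) + 1)")
    case True
    have "?P * (\<xi> ^ card S * (1 + real K * (\<xi> - 1)\<^sup>2))
        = \<xi> ^ card S * (?P * (1 + real K * (\<xi> - 1)\<^sup>2))"
      by (simp only: mult_ac)
    also have "\<dots> \<le> \<xi> ^ card S * ((1 + \<xi>) * ?Q)"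
      using prob_straddles_mult_one_plus_square_le[OF S(1,2) _ X(1,2) \<open>0 < K\<close>, of B E] S(4) \<open>0 \<le> \<xi>\<close>
      by (intro mult_left_mono) (simp_all add: \<xi>_def)
    also have "\<dots> = \<xi> ^ card S * (1 + \<xi>) * ?Q"
      by simp
    also have "\<dots> \<le> straddle_const (card S) * \<xi> * ?Q"
      using S(1,3) True \<open>0 \<le> \<xi>\<close> \<open>0 \<le> ?Q\<close>
      by (intro mult_right_mono power_mult_one_plus_le_straddle_const) (auto simp: card_gt_0_iff)
    finally show ?thesis .
  next
    case False
    have "4 * real (card S + 1) * real K \<le> real K * \<xi>"
      using False \<open>0 < K\<close> by simp
    moreover have "straddles K q E X = (\<lambda>h. hit_count E X h < K)"
      using False \<open>0 < K\<close> by (simp add: straddles_def[abs_def] \<mu>)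
    ultimately have few: "?P * (real K * \<xi>) ^ (card S + 1) \<le> straddle_const (card S) * ?Q"
      using prob_hit_count_less_mult_power_le[OF S(1,2) _ X(1,2) _ _ \<open>0 < K\<close>, of "card S + 1" E B]
        S(4) X(3)
      by (simp add: \<mu> straddle_const_def add_ac)
    have "?P * (\<xi> ^ card S * (1 + real K * (\<xi> - 1)\<^sup>2)) \<le> ?P * (\<xi> * (real K * \<xi>) ^ (card S + 1))"
      using False \<open>0 < K\<close> by (intro mult_left_mono power_mult_one_plus_square_le) auto
    also have "\<dots> = \<xi> * (?P * (real K * \<xi>) ^ (card S + 1))"
      by (simp only: mult_ac)
    also have "\<dots> \<le> \<xi> * (straddle_const (card S) * ?Q)"
      using few \<open>0 \<le> \<xi>\<close> by (rule mult_left_mono)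
    finally show ?thesis
      by (simp only: mult_ac)
  qed
qed

subsection \<open>Sums of the Cauchy kernel\<close>

definition cauchy_kernel :: "real \<Rightarrow> real" where
  "cauchy_kernel x = 1 / (1 + x\<^sup>2)"

lemma cauchy_kernel_le_arctan_diff:
  assumes "x < x'" "x' \<le> x + 1"
  shows "cauchy_kernel x \<le> 3 * (arctan x' - arctan x) / (x' - x)"
proof -
  obtain y where y: "x < y" "y < x'"
    and mvt: "arctan x' - arctan x = (x' - x) * inverse (1 + y\<^sup>2)"
    using MVT2[OF assms(1), of arctan "\<lambda>y. inverse (1 + y\<^sup>2)"] DERIV_arctan by blast
  have "\<bar>y - x\<bar> \<le> 1"
    using y assms by linarith
  then have "(y - x)\<^sup>2 \<le> 1"
    by (simp add: abs_square_le_1)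
  have "y\<^sup>2 \<le> 2 * (y - x)\<^sup>2 + 2 * x\<^sup>2"
    using zero_le_power2[of "y - 2 * x"] by (simp add: power2_eq_square algebra_simps)
  also have "\<dots> \<le> 2 * 1 + 2 * x\<^sup>2"
    using \<open>(y - x)\<^sup>2 \<le> 1\<close> by (intro add_mono mult_left_mono) auto
  finally have "1 + y\<^sup>2 \<le> 3 * (1 + x\<^sup>2)"
    using zero_le_power2[of x] by argo
  then have "cauchy_kernel x \<le> 3 * inverse (1 + y\<^sup>2)"
    by (simp add: cauchy_kernel_def field_simps add_pos_nonneg)
  also have "\<dots> = 3 * (arctan x' - arctan x) / (x' - x)"
    using assms(1) by (simp add: mvt)
  finally show ?thesis .
qed

lemma sum_cauchy_kernel_le:
  fixes a r :: real
  assumes "1 \<le> r"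
  shows "(\<Sum>t<n. cauchy_kernel ((real t - a) / r)) \<le> 12 * r"
proof -
  define x where "x t = (real t - a) / r" for t :: nat
  have kernel_le: "cauchy_kernel (x t) \<le> 3 * r * (arctan (x (Suc t)) - arctan (x t))" for t
  proof -
    have step: "x (Suc t) - x t = 1 / r"
      by (simp add: x_def diff_divide_distrib[symmetric])
    moreover have "0 < 1 / r" "1 / r \<le> 1"
      using assms by simp_all
    ultimately have "x t < x (Suc t)" "x (Suc t) \<le> x t + 1"
      by linarith+
    then show ?thesis
      using cauchy_kernel_le_arctan_diff[of "x t" "x (Suc t)"] unfolding step by (simp add: mult_ac)
  qed
  have "(\<Sum>t<n. cauchy_kernel (x t)) \<le> (\<Sum>t<n. 3 * r * (arctan (x (Suc t)) - arctan (x t)))"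
    by (intro sum_mono kernel_le)
  also have "\<dots> = 3 * r * (arctan (x n) - arctan (x 0))"
    using sum_lessThan_telescope[of "\<lambda>t. arctan (x t)" n] by (simp only: flip: sum_distrib_left)
  also have "\<dots> \<le> 3 * r * 4"
    using assms pi_less_4 arctan_ubound[of "x n"] arctan_lbound[of "x 0"]
    by (intro mult_left_mono) auto
  finally show ?thesis
    by (simp add: x_def)
qed

subsection \<open>Ranks of hash values\<close>

lemma less_nth_sorted_iff:
  fixes xs :: "'a::linorder list"
  assumes "sorted xs" "j < length xs"
  shows "t < xs ! j \<longleftrightarrow> length (filter (\<lambda>x. x \<le> t) xs) \<le> j"
  using assms
proof (induction xs arbitrary: j)
  case Nil
  then show ?case by simp
next
  case (Cons a xs)
  show ?case
  proof (cases j)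
    case 0
    then show ?thesis using Cons.prems
      by (auto simp: filter_empty_conv)
  next
    case (Suc i)
    have "filter (\<lambda>x. x \<le> t) xs = []" if "\<not> a \<le> t"
      using Cons.prems that by (auto simp: filter_empty_conv)
    moreover have "a \<le> xs ! i"
      using Cons.prems Suc by simp
    ultimately show ?thesis
      using Cons.prems Suc Cons.IH[of i] by auto
  qed
qed

lemma less_RANK_iff:
  assumes "1 \<le> j" "j \<le> size M"
  shows "t < RANK j M \<longleftrightarrow> size (filter_mset (\<lambda>x. x \<le> t) M) < j"
proof -
  define xs where "xs = sorted_list_of_multiset M"
  have M: "M = mset xs" and "sorted xs"
    by (simp_all add: xs_def)
  have "t < xs ! (j - 1) \<longleftrightarrow> length (filter (\<lambda>x. x \<le> t) xs) \<le> j - 1"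
    by (rule less_nth_sorted_iff[OF \<open>sorted xs\<close>]) (use assms M in auto)
  moreover have "size (filter_mset (\<lambda>x. x \<le> t) M) = length (filter (\<lambda>x. x \<le> t) xs)"
    by (simp add: M flip: mset_filter)
  ultimately show ?thesis
    using assms by (auto simp: RANK_def xs_def)
qed

lemma less_RANK_hash_values_iff:
  assumes "finite X" "1 \<le> j" "j \<le> card X"
  shows "t < RANK j (hash_values h X) \<longleftrightarrow> hit_count {..t} X h < j"
  using assms by (simp add: less_RANK_iff hash_values_def filter_mset_image_mset hit_count_def)

lemma RANK_card_hash_values:
  fixes h :: "'a \<Rightarrow> 'b::linorder"
  assumes "finite Y" "Y \<noteq> {}"
  shows "RANK (card Y) (hash_values h Y) = Max (h ` Y)"
proof -
  have "0 < card Y"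
    using assms by (simp add: card_gt_0_iff)
  have "t < RANK (card Y) (hash_values h Y) \<longleftrightarrow> t < Max (h ` Y)" for t
  proof -
    have "t < RANK (card Y) (hash_values h Y) \<longleftrightarrow> card {x \<in> Y. h x \<le> t} < card Y"
      using assms \<open>0 < card Y\<close> by (simp add: less_RANK_hash_values_iff hit_count_def)
    also have "\<dots> \<longleftrightarrow> (\<exists>x\<in>Y. t < h x)"
    proof
      assume "card {x \<in> Y. h x \<le> t} < card Y"
      then have "{x \<in> Y. h x \<le> t} \<noteq> Y"
        by auto
      then show "\<exists>x\<in>Y. t < h x"
        by (auto simp: not_le)
    next
      assume "\<exists>x\<in>Y. t < h x"
      then have "{x \<in> Y. h x \<le> t} \<subset> Y"
        by (auto simp: not_le[symmetric])
      then show "card {x \<in> Y. h x \<le> t} < card Y"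
        using assms(1) by (rule psubset_card_mono[rotated])
    qed
    also have "\<dots> \<longleftrightarrow> t < Max (h ` Y)"
      using assms by (simp add: Max_gr_iff)
    finally show ?thesis .
  qed
  then show ?thesis
    by (metis linorder_neqE less_irrefl)
qed

lemma RANK_less_RANK_iff:
  assumes "finite X" "finite Y" "Y \<noteq> {}" "1 \<le> j" "j \<le> card X"
  shows "RANK (card Y) (hash_values h Y) < RANK j (hash_values h X)
    \<longleftrightarrow> hit_count {..Max (h ` Y)} X h < j"
  using assms by (simp add: RANK_card_hash_values less_RANK_hash_values_iff)

subsection \<open>Ratios of binomial coefficients\<close>

lemma binomial_ratio_eq_prod:
  assumes "0 < K"
  shows "real (K + d - 1 choose d) / real (m + d choose d)
    = (\<Prod>i<d. (real K + real i) / (real m + 1 + real i))"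
proof -
  have "real (K + d - 1) - real d + 1 = real K" "real (m + d) - real d + 1 = real m + 1"
    using assms by (simp_all add: of_nat_diff)
  then have "real (K + d - 1 choose d) = pochhammer (real K) d / fact d"
      "real (m + d choose d) = pochhammer (real m + 1) d / fact d"
    by (simp_all only: binomial_gbinomial gbinomial_pochhammer')
  then show ?thesis
    by (simp add: pochhammer_prod prod_dividef atLeast0LessThan)
qed

lemma power_one_plus_minus_one_le:
  fixes \<delta> :: real
  assumes "0 \<le> \<delta>" "\<delta> \<le> 1"
  shows "(1 + \<delta>) ^ d - 1 \<le> 2 ^ d * \<delta>"
proof (induction d)
  case (Suc d)
  have "(1 + \<delta>) ^ d * \<delta> \<le> 2 ^ d * \<delta>"
    using assms by (intro mult_right_mono power_mono) auto
  then show ?case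
    using Suc by (simp add: algebra_simps)
qed (use assms in simp)

lemma abs_mult_ratio_minus_one_le:
  fixes K m i d x :: real
  assumes K: "1 \<le> K" "d \<le> K" "K \<le> m" and i: "0 \<le> i" "i + 1 \<le> d"
    and x: "(K - 1) / m \<le> x" "x \<le> K / m"
  shows "\<bar>x * ((m + 1 + i) / (K + i)) - 1\<bar> \<le> d / K"
proof -
  define c where "c = (m + 1 + i) / (K + i)"
  have "0 \<le> c"
    using K i by (simp add: c_def)
  have "x * c \<le> K / m * c"
    using x(2) \<open>0 \<le> c\<close> by (rule mult_right_mono)
  also have "\<dots> = K / (K + i) * (1 + (1 + i) / m)"
    using K i by (simp add: c_def field_simps)
  also have "\<dots> \<le> 1 * (1 + d / K)"
    using K i by (intro mult_mono add_left_mono frac_le) auto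
  finally have upper: "x * c \<le> 1 + d / K"
    by simp
  have "1 - d / K \<le> 1 - (1 + i) / (K + i)"
    using K i by (intro diff_left_mono frac_le) auto
  also have "\<dots> = (K - 1) / (K + i)"
    using K i by (simp add: field_simps)
  also have "\<dots> = (K - 1) / m * (m / (K + i))"
    using K by simp
  also have "\<dots> \<le> (K - 1) / m * c"
    unfolding c_def using K i by (intro mult_left_mono divide_right_mono) auto
  also have "\<dots> \<le> x * c"
    using x(1) \<open>0 \<le> c\<close> by (rule mult_right_mono)
  finally show ?thesis
    using upper unfolding c_def by linarith
qed

lemma abs_power_minus_binomial_ratio_le:
  fixes x :: real
  assumes K: "0 < K" "d \<le> K" "K \<le> m" and x: "(real K - 1) / real m \<le> x" "x \<le> real K / real m"
  defines "R \<equiv> real (K + d - 1 choose d) / real (m + d choose d)"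
  shows "\<bar>x ^ d - R\<bar> \<le> 2 ^ d * (real d / real K) * R"
proof -
  define b where "b i = (real K + real i) / (real m + 1 + real i)" for i
  have "0 \<le> R"
    by (simp add: R_def)
  have R: "R = (\<Prod>i<d. b i)"
    unfolding R_def b_def by (rule binomial_ratio_eq_prod[OF K(1)])
  have b: "b i \<noteq> 0" for i
    using K by (simp add: b_def)
  have ratio: "\<bar>x / b i - 1\<bar> \<le> real d / real K" if "i < d" for i
    using abs_mult_ratio_minus_one_le[of "real K" "real d" "real m" "real i" x] K x that
    by (simp add: b_def)
  have "x ^ d = (\<Prod>i<d. x / b i) * R"
    using b by (simp add: R prod_dividef)
  have "\<bar>(\<Prod>i<d. x / b i) - 1\<bar> \<le> (\<Prod>i<d. 1 + \<bar>x / b i - 1\<bar>) - 1"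
    using norm_prod_minus1_le_prod_minus1[of "\<lambda>i. x / b i - 1" "{..<d}"] by simp
  also have "\<dots> \<le> (1 + real d / real K) ^ d - 1"
    using prod_mono[of "{..<d}" "\<lambda>i. 1 + \<bar>x / b i - 1\<bar>" "\<lambda>_. 1 + real d / real K"] ratio by simp
  also have "\<dots> \<le> 2 ^ d * (real d / real K)"
    using K by (intro power_one_plus_minus_one_le) auto
  finally have "\<bar>(\<Prod>i<d. x / b i) - 1\<bar> * R \<le> 2 ^ d * (real d / real K) * R"
    using \<open>0 \<le> R\<close> by (rule mult_right_mono)
  then show ?thesis
    using \<open>x ^ d = _\<close> \<open>0 \<le> R\<close> by (simp add: abs_mult_pos left_diff_distrib)
qed

subsection \<open>Hash families as distributions on functions\<close>

lemma hash_family_imp_finite: "hash_family u H \<Longrightarrow> finite H"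
  unfolding hash_family_def by (meson finite_PiE finite_lessThan finite_subset)

lemma map_pmf_restrict_wise_independent:
  assumes wi: "wise_independent u l H" and S: "finite S" "S \<subseteq> {..<u}" "card S = l"
  shows "map_pmf (\<lambda>h. restrict h S) (pmf_of_set H) = Pi_pmf S undefined (\<lambda>_. pmf_of_set {..<u})"
proof (rule pmf_eqI)
  fix g :: "nat \<Rightarrow> nat"
  have H: "H \<noteq> {}" "H \<subseteq> {..<u} \<rightarrow>\<^sub>E {..<u}" "finite H"
    using wi hash_family_imp_finite by (auto simp: wise_independent_def hash_family_def)
  have range: "(\<lambda>h. restrict h S) ` H \<subseteq> S \<rightarrow>\<^sub>E {..<u}"
    using H(2) S(2) by fastforce
  have "pmf (map_pmf (\<lambda>h. restrict h S) (pmf_of_set H)) g = indicator (S \<rightarrow>\<^sub>E {..<u}) g / real (u ^ l)"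
  proof (cases "g \<in> S \<rightarrow>\<^sub>E {..<u}")
    case True
    obtain x where x: "bij_betw x {..<l} S"
      using ex_bij_betw_nat_finite[OF S(1)] S(3) by (auto simp: atLeast0LessThan)
    then have "inj_on x {..<l}" "x ` {..<l} \<subseteq> {..<u}" "(\<lambda>i. g (x i)) ` {..<l} \<subseteq> {..<u}"
      using S(2) True by (auto simp: bij_betw_def)
    then have "measure_pmf.prob (pmf_of_set H) {h. \<forall>i<l. h (x i) = g (x i)} = 1 / real u ^ l"
      using wi unfolding wise_independent_def by blast
    moreover have "(\<lambda>h. restrict h S) -` {g} = {h. \<forall>i<l. h (x i) = g (x i)}"
      using True bij_betw_imp_surj_on[OF x]
      by (force simp: restrict_def PiE_def extensional_def fun_eq_iff)
    ultimately show ?thesis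
      using True by (simp add: pmf_map)
  next
    case False
    then show ?thesis
      using range H(1,3) by (auto simp: set_pmf_iff[symmetric] pmf_eq_0_set_pmf)
  qed
  also have "\<dots> = pmf (pmf_of_set (S \<rightarrow>\<^sub>E {..<u})) g"
    using S by (subst pmf_of_set) (auto simp: PiE_eq_empty_iff card_PiE intro!: finite_PiE)
  also have "pmf_of_set (S \<rightarrow>\<^sub>E {..<u}) = Pi_pmf S undefined (\<lambda>_. pmf_of_set {..<u})"
    using S by (subst Pi_pmf_of_set)
      (auto simp: PiE_dflt_def PiE_def Pi_def extensional_def intro!: arg_cong[where f = pmf_of_set])
  finally show "pmf (map_pmf (\<lambda>h. restrict h S) (pmf_of_set H)) g
      = pmf (Pi_pmf S undefined (\<lambda>_. pmf_of_set {..<u})) g" .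
qed

text \<open>The bound \<open>l \<le> u\<close> is essential: for \<open>l > u\<close> every family is vacuously \<open>l\<close>-wise independent.\<close>

lemma wise_independent_imp_wise_iid:
  assumes wi: "wise_independent u l H" and "l \<le> u"
  shows "wise_iid l {..<u} (pmf_of_set {..<u}) (pmf_of_set H)"
proof
  have family: "hash_family u H"
    using wi by (simp add: wise_independent_def)
  then have "H \<noteq> {}"
    by (simp add: hash_family_def)
  then show "finite (set_pmf (pmf_of_set H))"
    using hash_family_imp_finite[OF family] by simp
  fix S :: "nat set"
  assume S: "finite S" "S \<subseteq> {..<u}" "card S \<le> l"
  obtain S' where S': "S \<subseteq> S'" "S' \<subseteq> {..<u}" "card S' = l" "finite S'"
    using exists_subset_between[of S l "{..<u}"] S(2,3) \<open>l \<le> u\<close> finite_subset by auto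
  have "map_pmf (\<lambda>h. restrict h S) (pmf_of_set H)
      = map_pmf (\<lambda>h. restrict h S) (map_pmf (\<lambda>h. restrict h S') (pmf_of_set H))"
    using S'(1) by (simp add: pmf.map_comp o_def Int_absorb1)
  also have "\<dots> = map_pmf (\<lambda>h. restrict h S) (Pi_pmf S' undefined (\<lambda>_. pmf_of_set {..<u}))"
    using map_pmf_restrict_wise_independent[OF wi S'(4,2,3)] by simp
  also have "\<dots> = Pi_pmf S undefined (\<lambda>_. pmf_of_set {..<u})"
    unfolding restrict_def by (rule Pi_pmf_subset[OF S'(4,1), symmetric])
  finally show "map_pmf (\<lambda>h. restrict h S) (pmf_of_set H)
      = Pi_pmf S undefined (\<lambda>_. pmf_of_set {..<u})" .
qed

subsection \<open>Comparing the largest value on \<open>Y\<close> with a rank of \<open>X\<close>\<close>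

lemma abs_prob_diff_le:
  assumes "\<And>x. \<lbrakk>x \<in> set_pmf p; P x \<noteq> Q x\<rbrakk> \<Longrightarrow> D x"
  shows "\<bar>measure_pmf.prob p {x. P x} - measure_pmf.prob p {x. Q x}\<bar> \<le> measure_pmf.prob p {x. D x}"
proof -
  have "measure_pmf.prob p {x. P' x} \<le> measure_pmf.prob p {x. Q' x} + measure_pmf.prob p {x. D x}"
    if "\<And>x. \<lbrakk>x \<in> set_pmf p; P' x \<noteq> Q' x\<rbrakk> \<Longrightarrow> D x" for P' Q'
  proof -
    have "measure_pmf.prob p {x. P' x} \<le> measure_pmf.prob p ({x. Q' x} \<union> {x. D x})"
      using that by (intro measure_pmf.finite_measure_mono_AE) (auto simp: AE_measure_pmf_iff)
    also have "\<dots> \<le> measure_pmf.prob p {x. Q' x} + measure_pmf.prob p {x. D x}"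
      by (intro measure_Un_le) auto
    finally show ?thesis .
  qed
  from this[of P Q] this[of Q P] assms show ?thesis
    by (force simp: abs_le_iff)
qed

lemma prob_pmf_of_set_lessThan:
  "\<lbrakk>0 < u; B \<subseteq> {..<u}\<rbrakk> \<Longrightarrow> measure_pmf.prob (pmf_of_set {..<u}) B = real (card B) / real u"
  by (subst measure_pmf_of_set) (auto simp: Int_absorb1)

locale min_wise_setting = wise_iid l A "pmf_of_set {..<u}" p
  for l u :: nat and A :: "'a set" and p :: "('a \<Rightarrow> nat) pmf" +
  fixes X Y :: "'a set" and K :: nat
  assumes Y: "finite Y" "Y \<subseteq> A" "Y \<noteq> {}" "3 * card Y + 2 \<le> l"
    and X: "finite X" "X \<subseteq> A - Y"
    and K: "card Y < K" "K \<le> card X" and card_X_le: "card X \<le> u"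
begin

definition cutoff :: real where
  "cutoff = real u * real K / real (card X)"

definition width :: real where
  "width = cutoff / sqrt (real K)"

abbreviation straddles_at :: "nat \<Rightarrow> ('a \<Rightarrow> nat) \<Rightarrow> bool" where
  "straddles_at t \<equiv> straddles K (pmf_of_set {..<u}) {..t} X"

lemma u_K_card_X_pos: "0 < u" "0 < K" "0 < card X"
  using K card_X_le by auto

lemma sqrt_K_le_K: "sqrt (real K) \<le> real K"
  using u_K_card_X_pos mult_left_mono[of 1 "sqrt (real K)" "sqrt (real K)"] by simp

lemma K_le_cutoff: "real K \<le> cutoff"
  using u_K_card_X_pos card_X_le mult_right_mono[of "real (card X)" "real u" "real K"]
  by (simp add: cutoff_def field_simps)

lemma cutoff_pos: "0 < cutoff"
  using K_le_cutoff u_K_card_X_pos by linarith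

lemma cutoff_div_u: "cutoff / real u = real K / real (card X)"
  using u_K_card_X_pos by (simp add: cutoff_def)

lemma cutoff_le_u: "cutoff \<le> real u"
  using u_K_card_X_pos K mult_left_mono[of "real K" "real (card X)" "real u"]
  by (simp add: cutoff_def field_simps)

lemma width_ge_1: "1 \<le> width"
  using sqrt_K_le_K K_le_cutoff u_K_card_X_pos by (simp add: width_def)

lemma expected_hit_count_ratio:
  assumes "t < u"
  shows "real (card X) * measure_pmf.prob (pmf_of_set {..<u}) {..t} / real K = real (Suc t) / cutoff"
  using assms u_K_card_X_pos prob_pmf_of_set_lessThan[of u "{..t}"]
  by (simp add: cutoff_def subset_eq del: of_nat_Suc)

lemma prod_prob_max_at:
  assumes "t < u" "y \<in> Y"
  shows "(\<Prod>x\<in>Y. measure_pmf.prob (pmf_of_set {..<u}) (if x = y then {t} else {..t}))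
    = (real (Suc t) / real u) ^ card Y / real (Suc t)"
proof -
  have "(\<Prod>x\<in>Y. measure_pmf.prob (pmf_of_set {..<u}) (if x = y then {t} else {..t}))
      = 1 / real u * (\<Prod>x\<in>Y - {y}. real (Suc t) / real u)"
    using assms u_K_card_X_pos Y(1)
    by (subst prod.remove[of _ y])
      (auto intro!: prod.cong simp: prob_pmf_of_set_lessThan subset_eq)
  also have "\<dots> = (real (Suc t) / real u) ^ card Y / real (Suc t)"
    using assms(2) Y(1,3) u_K_card_X_pos
    by (simp add: card_Diff_singleton power_eq_if card_gt_0_iff del: of_nat_Suc)
  finally show ?thesis .
qed

lemma prob_max_at_and_straddles_le:
  assumes "t < u" "y \<in> Y"
  shows "measure_pmf.prob p {h. (\<forall>x\<in>Y. h x \<in> (if x = y then {t} else {..t})) \<and> straddles_at t h}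
    \<le> straddle_const (card Y) * (cutoff / real u) ^ card Y / cutoff
      * cauchy_kernel ((real (Suc t) - cutoff) / width)"
    (is "?P \<le> _")
proof -
  define \<xi> where "\<xi> = real (Suc t) / cutoff"
  define W where "W = 1 + ((real (Suc t) - cutoff) / width)\<^sup>2"
  define C where "C = straddle_const (card Y) * (cutoff / real u) ^ card Y / cutoff"
  have "0 < \<xi>" "0 < W"
    using cutoff_pos by (auto simp: \<xi>_def W_def add_pos_nonneg)
  have "(real (Suc t) - cutoff) / width = sqrt (real K) * (\<xi> - 1)"
    using u_K_card_X_pos cutoff_pos by (simp add: \<xi>_def width_def field_simps)
  then have W: "1 + real K * (\<xi> - 1)\<^sup>2 = W"
    by (simp add: W_def power_mult_distrib)
  have "(real (Suc t) / real u) ^ card Y = \<xi> ^ card Y * (cutoff / real u) ^ card Y"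
    using cutoff_pos by (simp add: \<xi>_def flip: power_mult_distrib)
  then have all_in: "straddle_const (card Y) * \<xi>
        * (\<Prod>x\<in>Y. measure_pmf.prob (pmf_of_set {..<u}) (if x = y then {t} else {..t}))
      = \<xi> ^ card Y * C"
    by (simp add: prod_prob_max_at[OF assms] C_def \<xi>_def del: of_nat_Suc)
  have "card Y < card X"
    using K by simp
  have "?P * (\<xi> ^ card Y * W) \<le> \<xi> ^ card Y * C"
    using prob_straddles_le[OF Y X \<open>card Y < card X\<close> u_K_card_X_pos(2),
        of "\<lambda>x. if x = y then {t} else {..t}" "{..t}"]
    unfolding expected_hit_count_ratio[OF assms(1)] \<xi>_def[symmetric] W all_in .
  then have "\<xi> ^ card Y * (?P * W) \<le> \<xi> ^ card Y * C"
    by (simp only: mult_ac)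
  then have "?P * W \<le> C"
    using \<open>0 < \<xi>\<close> by simp
  then have "?P \<le> C * (1 / W)"
    using \<open>0 < W\<close> by (simp only: pos_le_divide_eq times_divide_eq_right mult_1_right)
  then show ?thesis
    by (simp only: cauchy_kernel_def C_def W_def)
qed

lemma prob_Max_eq_and_straddles_le:
  assumes "t < u"
  shows "measure_pmf.prob p {h. Max (h ` Y) = t \<and> straddles_at t h}
    \<le> real (card Y) * straddle_const (card Y) * (cutoff / real u) ^ card Y / cutoff
      * cauchy_kernel ((real (Suc t) - cutoff) / width)"
proof -
  define attained where
    "attained y = {h. (\<forall>x\<in>Y. h x \<in> (if x = y then {t} else {..t})) \<and> straddles_at t h}" for y
  have "{h. Max (h ` Y) = t \<and> straddles_at t h} \<subseteq> (\<Union>y\<in>Y. attained y)"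
  proof
    fix h assume h: "h \<in> {h. Max (h ` Y) = t \<and> straddles_at t h}"
    have "Max (h ` Y) \<in> h ` Y"
      using Y(1,3) by (intro Max_in) auto
    then obtain y where "y \<in> Y" "h y = t"
      using h by auto
    moreover have "h x \<le> t" if "x \<in> Y" for x
      using h Y(1) that by auto
    ultimately show "h \<in> (\<Union>y\<in>Y. attained y)"
      using h by (auto simp: attained_def)
  qed
  then have "measure_pmf.prob p {h. Max (h ` Y) = t \<and> straddles_at t h}
      \<le> measure_pmf.prob p (\<Union>y\<in>Y. attained y)"
    by (intro measure_pmf.finite_measure_mono) auto
  also have "\<dots> \<le> (\<Sum>y\<in>Y. measure_pmf.prob p (attained y))"
    using Y(1) by (intro measure_pmf.finite_measure_subadditive_finite) auto
  also have "\<dots> \<le> (\<Sum>y\<in>Y. straddle_const (card Y) * (cutoff / real u) ^ card Y / cutoff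
      * cauchy_kernel ((real (Suc t) - cutoff) / width))"
    unfolding attained_def by (intro sum_mono prob_max_at_and_straddles_le assms)
  finally show ?thesis
    by (simp add: mult.assoc)
qed

lemma Max_less_u:
  assumes "h \<in> set_pmf p"
  shows "Max (h ` Y) < u"
proof -
  have "h x < u" if "x \<in> Y" for x
  proof -
    have "pmf_of_set {..<u} = map_pmf (\<lambda>h. h x) p"
      using map_pmf_apply[of x] that Y by auto
    then have "h x \<in> set_pmf (pmf_of_set {..<u})"
      using assms by simp
    then show ?thesis
      using u_K_card_X_pos by (subst (asm) set_pmf_of_set) auto
  qed
  then show ?thesis
    using Y by simp
qed

lemma prob_straddles_at_Max_le:
  "measure_pmf.prob p {h. straddles_at (Max (h ` Y)) h}
    \<le> 12 * real (card Y) * straddle_const (card Y) * (real K / real (card X)) ^ card Y / sqrt (real K)"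
proof -
  define C where
    "C = real (card Y) * straddle_const (card Y) * (cutoff / real u) ^ card Y / cutoff"
  have "measure_pmf.prob p {h. straddles_at (Max (h ` Y)) h}
      \<le> measure_pmf.prob p (\<Union>t<u. {h. Max (h ` Y) = t \<and> straddles_at t h})"
    using Max_less_u by (intro measure_pmf.finite_measure_mono_AE) (auto simp: AE_measure_pmf_iff)
  also have "\<dots> \<le> (\<Sum>t<u. measure_pmf.prob p {h. Max (h ` Y) = t \<and> straddles_at t h})"
    by (intro measure_pmf.finite_measure_subadditive_finite) auto
  also have "\<dots> \<le> (\<Sum>t<u. C * cauchy_kernel ((real (Suc t) - cutoff) / width))"
    unfolding C_def by (intro sum_mono prob_Max_eq_and_straddles_le) auto
  also have "\<dots> = C * (\<Sum>t<u. cauchy_kernel ((real t - (cutoff - 1)) / width))"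
    by (simp add: sum_distrib_left algebra_simps)
  also have "\<dots> \<le> C * (12 * width)"
    using cutoff_pos
    by (intro mult_left_mono sum_cauchy_kernel_le[OF width_ge_1]) (auto simp: C_def straddle_const_def)
  also have "\<dots> = 12 * real (card Y) * straddle_const (card Y) * (cutoff / real u) ^ card Y / sqrt (real K)"
    using cutoff_pos by (simp add: C_def width_def)
  finally show ?thesis
    unfolding cutoff_div_u .
qed

lemma prob_Max_less:
  assumes "s \<le> u"
  shows "measure_pmf.prob p {h. Max (h ` Y) < s} = (real s / real u) ^ card Y"
proof -
  have "{h. Max (h ` Y) < s} = {h. \<forall>x\<in>Y. h x \<in> {..<s}}"
    using Y(1,3) by auto
  then show ?thesis
    using prob_all_in[OF Y(1,2), of "\<lambda>_. {..<s}"] prob_pmf_of_set_lessThan[OF u_K_card_X_pos(1), of "{..<s}"]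
      Y(4) assms
    by simp
qed

lemma prob_hit_count_Max_less_approx:
  "\<bar>measure_pmf.prob p {h. hit_count {..Max (h ` Y)} X h < K}
      - (real (nat \<lfloor>cutoff\<rfloor>) / real u) ^ card Y\<bar>
    \<le> 12 * real (card Y) * straddle_const (card Y) * (real K / real (card X)) ^ card Y / sqrt (real K)"
proof -
  have "nat \<lfloor>cutoff\<rfloor> \<le> u"
    using cutoff_le_u by linarith
  have "straddles_at (Max (h ` Y)) h"
    if h: "h \<in> set_pmf p"
      and ne: "(hit_count {..Max (h ` Y)} X h < K) \<noteq> (Max (h ` Y) < nat \<lfloor>cutoff\<rfloor>)" for h
  proof -
    define t where "t = Max (h ` Y)"
    have "real (card X) * measure_pmf.prob (pmf_of_set {..<u}) {..t} \<le> real K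
        \<longleftrightarrow> real (card X) * measure_pmf.prob (pmf_of_set {..<u}) {..t} / real K \<le> 1"
      using u_K_card_X_pos by (simp add: divide_le_eq_1)
    also have "\<dots> \<longleftrightarrow> real (Suc t) / cutoff \<le> 1"
      unfolding t_def expected_hit_count_ratio[OF Max_less_u[OF h]] ..
    also have "\<dots> \<longleftrightarrow> t < nat \<lfloor>cutoff\<rfloor>"
      using cutoff_pos by (simp add: divide_le_eq_1) linarith
    finally show ?thesis
      using ne by (simp add: straddles_def t_def)
  qed
  then have "\<bar>measure_pmf.prob p {h. hit_count {..Max (h ` Y)} X h < K}
        - measure_pmf.prob p {h. Max (h ` Y) < nat \<lfloor>cutoff\<rfloor>}\<bar>
      \<le> measure_pmf.prob p {h. straddles_at (Max (h ` Y)) h}"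
    by (rule abs_prob_diff_le)
  then show ?thesis
    using prob_straddles_at_Max_le unfolding prob_Max_less[OF \<open>nat \<lfloor>cutoff\<rfloor> \<le> u\<close>] by linarith
qed

lemma floor_cutoff_div_u_bounds:
  "(real K - 1) / real (card X) \<le> real (nat \<lfloor>cutoff\<rfloor>) / real u"
  "real (nat \<lfloor>cutoff\<rfloor>) / real u \<le> real K / real (card X)"
proof -
  have "(real K - 1) / real (card X) = cutoff / real u - 1 / real (card X)"
    by (simp add: cutoff_div_u diff_divide_distrib)
  also have "\<dots> \<le> cutoff / real u - 1 / real u"
    using u_K_card_X_pos card_X_le by (intro diff_left_mono divide_left_mono) auto
  also have "\<dots> = (cutoff - 1) / real u"
    by (rule diff_divide_distrib[symmetric])
  also have "\<dots> \<le> real (nat \<lfloor>cutoff\<rfloor>) / real u"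
    by (intro divide_right_mono) linarith+
  finally show "(real K - 1) / real (card X) \<le> real (nat \<lfloor>cutoff\<rfloor>) / real u" .
  have "real (nat \<lfloor>cutoff\<rfloor>) / real u \<le> cutoff / real u"
    using cutoff_pos by (intro divide_right_mono) auto
  then show "real (nat \<lfloor>cutoff\<rfloor>) / real u \<le> real K / real (card X)"
    by (simp add: cutoff_div_u)
qed

end

definition min_wise_const :: "nat \<Rightarrow> real" where
  "min_wise_const d = 12 * real d * straddle_const d * (1 + 2 ^ d * real d) + 2 ^ d * real d"

lemma (in min_wise_setting) prob_hit_count_Max_less_approx_binomial_ratio:
  defines "R \<equiv> real (K + card Y - 1 choose card Y) / real (card X + card Y choose card Y)"
  shows "\<bar>measure_pmf.prob p {h. hit_count {..Max (h ` Y)} X h < K} - R\<bar>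
    \<le> min_wise_const (card Y) * R / sqrt (real K)"
proof -
  define M where "M = 12 * real (card Y) * straddle_const (card Y)"
  define \<Delta> where "\<Delta> = 2 ^ card Y * real (card Y) * R"
  have "0 \<le> \<Delta>" "0 \<le> M"
    by (simp_all add: R_def \<Delta>_def M_def straddle_const_def)
  have approx: "\<bar>x ^ card Y - R\<bar> \<le> \<Delta> / real K"
    if "(real K - 1) / real (card X) \<le> x" "x \<le> real K / real (card X)" for x
    using abs_power_minus_binomial_ratio_le[OF u_K_card_X_pos(2) less_imp_le[OF K(1)] K(2) that]
    unfolding \<Delta>_def R_def by (simp add: mult_ac)
  have "\<Delta> / real K \<le> \<Delta> / sqrt (real K)" "\<Delta> / real K \<le> \<Delta> / 1"
    using u_K_card_X_pos sqrt_K_le_K \<open>0 \<le> \<Delta>\<close> by (intro divide_left_mono; simp)+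
  then have floor: "\<bar>(real (nat \<lfloor>cutoff\<rfloor>) / real u) ^ card Y - R\<bar> \<le> \<Delta> / sqrt (real K)"
    and ratio: "(real K / real (card X)) ^ card Y \<le> R + \<Delta>"
    using approx[OF floor_cutoff_div_u_bounds] approx[of "real K / real (card X)"]
    by (simp_all add: divide_right_mono)
  have "\<bar>measure_pmf.prob p {h. hit_count {..Max (h ` Y)} X h < K} - R\<bar>
      \<le> M * (real K / real (card X)) ^ card Y / sqrt (real K) + \<Delta> / sqrt (real K)"
    using prob_hit_count_Max_less_approx floor unfolding M_def by linarith
  also have "\<dots> \<le> M * (R + \<Delta>) / sqrt (real K) + \<Delta> / sqrt (real K)"
    using ratio \<open>0 \<le> M\<close> by (intro add_right_mono divide_right_mono mult_left_mono) auto
  also have "\<dots> = (M * (R + \<Delta>) + \<Delta>) / sqrt (real K)"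
    by (rule add_divide_distrib[symmetric])
  also have "M * (R + \<Delta>) + \<Delta> = min_wise_const (card Y) * R"
    by (simp add: min_wise_const_def M_def \<Delta>_def algebra_simps)
  finally show ?thesis .
qed

subsection \<open>Approximate min-wise independence\<close>

lemma min_wise_const_ge_1:
  assumes "0 < d"
  shows "1 \<le> min_wise_const d"
proof -
  have "1 * 1 \<le> 2 ^ d * real d"
    using assms by (intro mult_mono) auto
  moreover have "0 \<le> 12 * real d * straddle_const d * (1 + 2 ^ d * real d)"
    by (simp add: straddle_const_def)
  ultimately show ?thesis
    by (simp add: min_wise_const_def)
qed

lemma approx_min_wise_independent_if_rank_ge:
  assumes wi: "wise_independent u l H" and d: "0 < d" "3 * d + 2 \<le> l" and \<epsilon>: "0 < \<epsilon>" "\<epsilon> < 1"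
    and rank: "l \<le> k - d + 1" "(min_wise_const d / \<epsilon>)\<^sup>2 \<le> real (k - d + 1)"
  shows "approx_min_wise_independent u d k \<epsilon> H"
  unfolding approx_min_wise_independent_def
proof (intro conjI allI impI)
  define K where "K = k - d + 1"
  have K: "K + d - 1 = k" "d < K" "1 \<le> K" "l \<le> K"
    using d rank(1) by (auto simp: K_def)
  show "hash_family u H" "0 < \<epsilon>" "\<epsilon> < 1" "d \<le> k"
    using wi \<epsilon> d rank(1) by (auto simp: wise_independent_def)
  fix n :: nat and X Y :: "nat set"
  assume "X \<subseteq> {..<u} \<and> Y \<subseteq> {..<u} \<and> X \<inter> Y = {} \<and>
    d \<le> n \<and> card X = n - d \<and> card Y = d \<and> k - d + 1 \<le> card X"
  then have X: "X \<subseteq> {..<u} - Y" "K \<le> card X" "card X + d = n" "finite X"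
    and Y: "Y \<subseteq> {..<u}" "card Y = d" "finite Y" "Y \<noteq> {}"
    using d(1) by (auto simp: K_def intro: finite_subset)
  have "card X \<le> u"
    using X(1) card_mono[of "{..<u}" X] by auto
  then interpret wise_iid l "{..<u}" "pmf_of_set {..<u}" "pmf_of_set H"
    using wi K(4) X(2) by (intro wise_independent_imp_wise_iid) auto
  interpret setting: min_wise_setting l u "{..<u}" "pmf_of_set H" X Y K
    by unfold_locales (use X Y d K(2) \<open>card X \<le> u\<close> in auto)
  define P where "P = measure_pmf.prob (pmf_of_set H)
      {h. RANK d (hash_values h Y) < RANK (k - d + 1) (hash_values h X)}"
  define R where "R = real (k choose d) / real (n choose d)"
  have "RANK d (hash_values h Y) < RANK (k - d + 1) (hash_values h X)
      \<longleftrightarrow> hit_count {..Max (h ` Y)} X h < K" for h :: "nat \<Rightarrow> nat"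
    using RANK_less_RANK_iff[OF X(4) Y(3,4) K(3) X(2)] by (simp only: Y(2) K_def)
  then have "P = measure_pmf.prob (pmf_of_set H) {h. hit_count {..Max (h ` Y)} X h < K}"
    by (simp only: P_def)
  then have "\<bar>P - R\<bar> \<le> min_wise_const d * R / sqrt (real K)"
    using setting.prob_hit_count_Max_less_approx_binomial_ratio
    by (simp only: R_def X(3) Y(2) K(1))
  also have "\<dots> = min_wise_const d / sqrt (real K) * R"
    by simp
  also have "\<dots> \<le> \<epsilon> * R"
  proof (rule mult_right_mono)
    have "min_wise_const d / \<epsilon> \<le> sqrt (real K)"
      using rank(2) by (intro real_le_rsqrt) (simp add: K_def)
    then show "min_wise_const d / sqrt (real K) \<le> \<epsilon>"
      using \<epsilon>(1) K(3) by (simp add: field_simps)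
  qed (simp add: R_def)
  finally show "P \<in> {R * (1 - \<epsilon>)..R * (1 + \<epsilon>)}"
    by (simp add: algebra_simps abs_le_iff)
qed

lemma mult_le_powr_bound:
  fixes l a :: real
  assumes "1 \<le> l" "0 \<le> a"
  shows "l * a \<le> 2 * 8 powr (2 / l) * ((6 * l) powr (1 + 1 / l) * a)"
proof -
  have "(6 * l) powr 1 \<le> (6 * l) powr (1 + 1 / l)"
    using assms by (intro powr_mono) auto
  then have "l \<le> (6 * l) powr (1 + 1 / l)"
    using assms by simp
  moreover have "1 \<le> 2 * 8 powr (2 / l)"
    using ge_one_powr_ge_zero[of 8 "2 / l"] assms by simp
  ultimately have "1 * (l * a) \<le> 2 * 8 powr (2 / l) * ((6 * l) powr (1 + 1 / l) * a)"
    using assms by (intro mult_mono) auto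
  then show ?thesis
    by simp
qed

lemma approx_min_wise_independent_if_powr_less:
  assumes wi: "wise_independent u l H" and d: "0 < d" "3 * d + 2 \<le> l" and \<epsilon>: "0 < \<epsilon>" "\<epsilon> < 1"
    and k: "real d - 1 + 2 * 8 powr (2 / real l)
      * ((6 * real l) powr (1 + 1 / real l) / (\<epsilon> / min_wise_const d)\<^sup>2) < real k"
  shows "approx_min_wise_independent u d k \<epsilon> H"
proof (rule approx_min_wise_independent_if_rank_ge[OF wi d \<epsilon>])
  define a where "a = (min_wise_const d / \<epsilon>)\<^sup>2"
  have "1 \<le> l"
    using d(2) by simp
  have "real l * a \<le> 2 * 8 powr (2 / real l)
      * ((6 * real l) powr (1 + 1 / real l) / (\<epsilon> / min_wise_const d)\<^sup>2)"
    using mult_le_powr_bound[of "real l" a] \<open>1 \<le> l\<close> by (simp add: a_def power_divide)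
  then have "real l * a < real k - real d + 1"
    using k by linarith
  moreover have "1 \<le> a"
    using min_wise_const_ge_1[OF d(1)] \<epsilon> unfolding a_def by (intro one_le_power) simp
  then have "real l * 1 \<le> real l * a" "1 * a \<le> real l * a"
    using \<open>1 \<le> l\<close> by (intro mult_left_mono mult_right_mono; simp)+
  ultimately show "l \<le> k - d + 1" "(min_wise_const d / \<epsilon>)\<^sup>2 \<le> real (k - d + 1)"
    unfolding a_def[symmetric] by linarith+
qed

theorem theorem1:
  "\<exists>c::real. c > 0 \<and>
     (\<forall>(d::nat) (\<epsilon>::real) (\<epsilon>'::real) (k::nat) (l::nat) (u::nat) (H :: (nat \<Rightarrow> nat) set).
        d = 2 \<longrightarrow> 0 < \<epsilon> \<longrightarrow> \<epsilon> < 1 \<longrightarrow> \<epsilon>' = \<epsilon> / c \<longrightarrow>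
        k > 0 \<longrightarrow> l > 0 \<longrightarrow>
        real k > real d - 1
                 + 2 * 8 powr (2 / real l) * ((6 * real l) powr (1 + 1 / real l) / \<epsilon>'\<^sup>2) \<longrightarrow>
        l \<ge> 3 * d + 2 \<longrightarrow>
        wise_independent u l H \<longrightarrow>
        approx_min_wise_independent u d k \<epsilon> H)"
proof (intro exI[of _ "min_wise_const 2"] conjI allI impI)
  show "0 < min_wise_const 2"
    using min_wise_const_ge_1[of 2] by simp
  fix d k l u :: nat and \<epsilon> \<epsilon>' :: real and H :: "(nat \<Rightarrow> nat) set"
  assume "d = 2" "\<epsilon>' = \<epsilon> / min_wise_const 2" "0 < \<epsilon>" "\<epsilon> < 1" "3 * d + 2 \<le> l" "wise_independent u l H"
    "real d - 1 + 2 * 8 powr (2 / real l) * ((6 * real l) powr (1 + 1 / real l) / \<epsilon>'\<^sup>2) < real k"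
  then show "approx_min_wise_independent u d k \<epsilon> H"
    by (intro approx_min_wise_independent_if_powr_less) simp_all
qed

end
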